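(* Let $V\simeq\mathbb C^n$, let $f\in\mathbb C[V^*]$ be a nonzero homogeneous polynomial of degree $d$, and let $X=\{\mathsf x : f(\mathsf x)=0\}\subset\mathbb PV\simeq\mathbb{CP}^{n-1}$ be the corresponding hypersurface. The Hilbert series of the inverse system $C(\rho_f)$ is $$\mathrm{Hilb}(C(\rho_f);q)=\left(\sum_{i=0}^{d-1}\binom{n+i-1}{i}q^i\right)+q^d$$ if and only if $X$ is smooth.
   Context: $\mathbb C[V^*]$ is the algebra of polynomial functions on $V$. For nonzero $h\in V$, $\rho_f(h)$ is the degree of the restriction of $f$ to a generic affine line parallel to $h$, i.e. $\max_{a\in V}\deg_t f(a+th)$. $C(\rho_f)$ is the space of $g\in\mathbb C[V^*]$ such that for every nonzero $h\in V$ the restriction of $g$ to every affine line of direction $h$ has degree at most $\rho_f(h)$; it is graded by degree, and $\mathrm{Hilb}(C;q)=\sum_i\dim C_i\,q^i$. The hypersurface $X$ is smooth if there is no point of $\mathbb PV$ at which $f$ and all its first partial derivatives vanish (i.e. $f$ vanishes to order at least $2$ at no point of $\mathbb PV$). *)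

theory Defs
  imports
    "HOL-Analysis.Analysis"
    "HOL-Library.Function_Algebras"
begin

global_interpretation cfun: vector_space
  "\<lambda>(c::complex) (f::'a \<Rightarrow> complex) x. c * f x"
  by unfold_locales (auto simp: fun_eq_iff algebra_simps)

definition monomial_fun :: "('n::finite \<Rightarrow> nat) \<Rightarrow> complex ^ 'n \<Rightarrow> complex" where
  "monomial_fun m = (\<lambda>x. \<Prod>j\<in>UNIV. (x $ j) ^ m j)"

definition polynomial_functions :: "(complex ^ 'n::finite \<Rightarrow> complex) set" where
  "polynomial_functions = cfun.span (range monomial_fun)"

definition homogeneous_polynomials :: "nat \<Rightarrow> (complex ^ 'n::finite \<Rightarrow> complex) set" where
  "homogeneous_polynomials d = cfun.span {monomial_fun m | m. (\<Sum>j\<in>UNIV. m j) = d}"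

definition line_restriction ::
  "(complex ^ 'n::finite \<Rightarrow> complex) \<Rightarrow> complex ^ 'n \<Rightarrow> complex ^ 'n \<Rightarrow> complex poly" where
  "line_restriction g a h = (THE p. \<forall>t. poly p t = g (a + t *s h))"

lemma line_restriction_bounded:
  assumes "g \<in> polynomial_functions"
  shows "\<exists>D. \<forall>a h. \<exists>p. degree p \<le> D \<and> (\<forall>t. poly p t = g (a + t *s h))"
  using assms unfolding polynomial_functions_def
proof (induction rule: cfun.span_induct_alt)
  case base
  show ?case by (intro exI[of _ 0] allI) (auto intro!: exI[of _ 0])
next
  case (step c b g)
  then obtain m D where m: "b = monomial_fun m"
    and D: "\<And>a h. \<exists>p. degree p \<le> D \<and> (\<forall>t. poly p t = g (a + t *s h))"
    by blast
  have "\<exists>p. degree p \<le> max (sum m UNIV) D \<and>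
      (\<forall>t. poly p t = ((\<lambda>x. c * b x) + g) (a + t *s h))" for a h
  proof -
    obtain p where p: "degree p \<le> D" "\<And>t. poly p t = g (a + t *s h)"
      using D by blast
    let ?q = "\<Prod>j\<in>UNIV. [:a $ j, h $ j:] ^ m j"
    have "degree ?q \<le> (\<Sum>j\<in>UNIV. degree ([:a $ j, h $ j:] ^ m j))"
      using degree_prod_sum_le[of UNIV "\<lambda>j. [:a $ j, h $ j:] ^ m j"] by (simp add: o_def)
    also have "\<dots> \<le> sum m UNIV"
    proof (rule sum_mono)
      fix j
      have "degree ([:a $ j, h $ j:] ^ m j) \<le> degree [:a $ j, h $ j:] * m j"
        by (rule degree_power_le)
      also have "\<dots> \<le> 1 * m j" by (intro mult_right_mono) auto
      finally show "degree ([:a $ j, h $ j:] ^ m j) \<le> m j" by simp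
    qed
    finally have q: "degree ?q \<le> sum m UNIV" .
    have "degree (smult c ?q + p) \<le> max (sum m UNIV) D"
      using q p(1) degree_smult_le[of c ?q] by (intro degree_add_le) linarith+
    moreover have "poly (smult c ?q + p) t = ((\<lambda>x. c * b x) + g) (a + t *s h)" for t
      by (simp add: p(2) m monomial_fun_def poly_prod)
    ultimately show ?thesis by blast
  qed
  then show ?case by blast
qed

lemma poly_line_restriction:
  assumes "g \<in> polynomial_functions"
  shows "poly (line_restriction g a h) t = g (a + t *s h)"
proof -
  obtain D where "\<forall>a h. \<exists>p. degree p \<le> D \<and> (\<forall>t. poly p t = g (a + t *s h))"
    using line_restriction_bounded[OF assms] by (rule exE)
  from this[rule_format, of a h]
  obtain p where p: "\<forall>t. poly p t = g (a + t *s h)"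
    by (elim exE conjE)
  have "line_restriction g a h = p"
    unfolding line_restriction_def
  proof (rule the_equality)
    show "\<forall>t. poly p t = g (a + t *s h)" by (rule p)
  next
    fix q assume q: "\<forall>t. poly q t = g (a + t *s h)"
    have "poly q = poly p"
      by (rule ext) (simp only: p[rule_format] q[rule_format])
    then show "q = p" by (simp only: poly_eq_poly_eq_iff)
  qed
  then show ?thesis by (simp only: p[rule_format])
qed

text \<open>The zero polynomial has degree 0 in the library; this does not affect the maximum
  for nonzero \<open>f\<close>, since some line in direction \<open>h\<close> meets the complement of the zero set.\<close>

definition rho :: "(complex ^ 'n::finite \<Rightarrow> complex) \<Rightarrow> complex ^ 'n \<Rightarrow> nat" where
  "rho f h = Max (range (\<lambda>a. degree (line_restriction f a h)))"

lemma finite_line_degrees: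
  assumes "f \<in> polynomial_functions"
  shows "finite (range (\<lambda>a. degree (line_restriction f a h)))"
proof -
  obtain D where D: "\<forall>a h. \<exists>p. degree p \<le> D \<and> (\<forall>t. poly p t = f (a + t *s h))"
    using line_restriction_bounded[OF assms] by (rule exE)
  have "degree (line_restriction f a h) \<le> D" for a
  proof -
    from D[rule_format, of a h]
    obtain p where p: "degree p \<le> D" "\<forall>t. poly p t = f (a + t *s h)"
      by (elim exE conjE)
    then have "poly p = poly (line_restriction f a h)"
      by (intro ext) (simp add: poly_line_restriction[OF assms])
    then show ?thesis using p(1) by (simp add: poly_eq_poly_eq_iff)
  qed
  then have "range (\<lambda>a. degree (line_restriction f a h)) \<subseteq> {..D}" by auto
  then show ?thesis by (rule finite_subset) simp
qed

definition inverse_system :: "(complex ^ 'n::finite \<Rightarrow> nat) \<Rightarrow> (complex ^ 'n \<Rightarrow> complex) set" where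
  "inverse_system \<rho> = {g \<in> polynomial_functions.
     \<forall>h. h \<noteq> 0 \<longrightarrow> (\<forall>a. degree (line_restriction g a h) \<le> \<rho> h)}"

definition hilbert_series :: "(complex ^ 'n::finite \<Rightarrow> complex) set \<Rightarrow> int fps" where
  "hilbert_series C = Abs_fps (\<lambda>i. int (cfun.dim (C \<inter> homogeneous_polynomials i)))"

definition projective_space :: "(complex ^ 'n::finite) set set" where
  "projective_space = {vec.span {x} | x. x \<noteq> 0}"

definition partial_derivative ::
  "'n::finite \<Rightarrow> (complex ^ 'n \<Rightarrow> complex) \<Rightarrow> complex ^ 'n \<Rightarrow> complex" where
  "partial_derivative i f x = deriv (\<lambda>t. f (x + t *s axis i 1)) 0"

text \<open>Homogeneous coordinates of a point of projective space are the nonzero vectors on the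
  corresponding line; the vanishing of a homogeneous \<open>f\<close> and of its partial derivatives does
  not depend on their choice.\<close>

definition smooth_hypersurface :: "(complex ^ 'n::finite \<Rightarrow> complex) \<Rightarrow> bool" where
  "smooth_hypersurface f \<longleftrightarrow>
     \<not> (\<exists>L\<in>projective_space. \<forall>x\<in>L - {0}. f x = 0 \<and> (\<forall>i. partial_derivative i f x = 0))"

end

theory Submission
  imports Defs "HOL-Computational_Algebra.Fundamental_Theorem_Algebra"
begin

text \<open>
  The coefficients of \<open>t\<^sup>d\<close> and \<open>t\<^sup>d\<^sup>-\<^sup>1\<close> in \<open>f (a + t h)\<close> are \<open>f h\<close> and \<open>\<Sum>\<^sub>i a\<^sub>i \<partial>\<^sub>i f h\<close>, so \<open>rho f h\<close>
  is \<open>d\<close> off \<open>X\<close>, \<open>d - 1\<close> at the smooth points of \<open>X\<close> and at most \<open>d - 2\<close> at its singular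
  points. A singular point therefore imposes a vanishing condition on forms of degree \<open>d - 1\<close>
  and makes the Hilbert function drop in that degree. If \<open>X\<close> is smooth, there is no condition in
  degrees below \<open>d\<close>, and a form \<open>g\<close> of degree \<open>d\<close> belongs to the inverse system iff it vanishes
  on \<open>X\<close>.

  That such a \<open>g\<close> is a multiple of \<open>f\<close> is shown without the Nullstellensatz. Some line meets \<open>X\<close>
  in \<open>d\<close> distinct points: at a multiple intersection point \<open>p\<close> one tilts the line about \<open>p\<close> in a
  direction transversal to \<open>X\<close>, whereupon \<open>p\<close> becomes a simple intersection, the other points
  persist by continuity of roots and a new one splits off from \<open>p\<close>. The same holds for all nearby
  parallel lines, on which \<open>g\<close> is then proportional to \<open>f\<close> with the factor \<open>g e / f e\<close> given by
  the direction \<open>e\<close>; hence \<open>g\<close> is proportional to \<open>f\<close> everywhere.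
\<close>

section \<open>Restriction of homogeneous polynomials to lines\<close>

lemma homogeneous_imp_polynomial:
  assumes "g \<in> homogeneous_polynomials i"
  shows "g \<in> polynomial_functions"
proof -
  have "homogeneous_polynomials i \<subseteq> (polynomial_functions :: (complex ^ 'a \<Rightarrow> complex) set)"
    unfolding homogeneous_polynomials_def polynomial_functions_def
    by (intro cfun.span_mono) auto
  then show ?thesis using assms by blast
qed

lemma homogeneous_scale:
  assumes "g \<in> homogeneous_polynomials i"
  shows "g (c *s x) = c ^ i * g x"
  using assms unfolding homogeneous_polynomials_def
proof (induction rule: cfun.span_induct_alt)
  case (step k b g)
  then obtain m where "b = monomial_fun m" "sum m UNIV = i" by blast
  then have "b (c *s x) = c ^ i * b x"
    by (simp add: monomial_fun_def power_mult_distrib prod.distrib flip: power_sum)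
  then show ?case using step by (simp add: algebra_simps)
qed simp

text \<open>The difference multiplied by \<open>t\<close> vanishes everywhere, so agreement off
  \<open>t = 0\<close> is enough. This form suits the substitution of \<open>inverse t\<close> for
  \<open>t\<close> in \<open>coeff_line_restriction_swap\<close>.\<close>

lemma line_restriction_eqI:
  assumes "g \<in> polynomial_functions" "\<And>t. t \<noteq> 0 \<Longrightarrow> poly p t = g (a + t *s h)"
  shows "line_restriction g a h = p"
proof -
  let ?q = "[:0, 1:] * (line_restriction g a h - p)"
  have "poly ?q t = poly 0 t" for t
    using assms by (cases "t = 0") (auto simp: poly_line_restriction)
  then have "?q = 0" by (intro poly_eq_poly_eq_iff[THEN iffD1]) auto
  then show ?thesis by simp
qed

text \<open>A monomial of total degree \<open>i\<close> restricts to a product of \<open>i\<close>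
  polynomials of degree at most 1.\<close>

lemma degree_line_restriction_homogeneous:
  assumes "g \<in> homogeneous_polynomials i"
  shows "degree (line_restriction g a h) \<le> i"
proof -
  have "\<exists>p. degree p \<le> i \<and> (\<forall>t. poly p t = g (a + t *s h))"
    using assms unfolding homogeneous_polynomials_def
  proof (induction rule: cfun.span_induct_alt)
    case base
    show ?case by (intro exI[of _ 0]) auto
  next
    case (step c b g)
    then obtain m p where m: "b = monomial_fun m" "sum m UNIV = i"
      and p: "degree p \<le> i" "\<And>t. poly p t = g (a + t *s h)" by blast
    let ?q = "\<Prod>j\<in>UNIV. [:a $ j, h $ j:] ^ m j"
    have "degree ?q \<le> (\<Sum>j\<in>UNIV. degree ([:a $ j, h $ j:] ^ m j))"
      using degree_prod_sum_le[of UNIV "\<lambda>j. [:a $ j, h $ j:] ^ m j"] by (simp add: o_def)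
    also have "\<dots> \<le> sum m UNIV"
    proof (rule sum_mono)
      fix j
      have "degree ([:a $ j, h $ j:] ^ m j) \<le> degree [:a $ j, h $ j:] * m j"
        by (rule degree_power_le)
      also have "\<dots> \<le> 1 * m j" by (intro mult_right_mono) auto
      finally show "degree ([:a $ j, h $ j:] ^ m j) \<le> m j" by simp
    qed
    finally have "degree (smult c ?q + p) \<le> i"
      using m(2) p(1) degree_smult_le[of c ?q] by (intro degree_add_le) linarith+
    moreover have "poly (smult c ?q + p) t = ((\<lambda>x. c * b x) + g) (a + t *s h)" for t
      by (simp add: p(2) m(1) monomial_fun_def poly_prod)
    ultimately show ?case by blast
  qed
  then obtain p where "degree p \<le> i" "\<And>t. poly p t = g (a + t *s h)" by blast
  then show ?thesis
    using line_restriction_eqI[OF homogeneous_imp_polynomial[OF assms], of p a h] by simp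
qed

text \<open>By homogeneity \<open>g (a + t h) = t^i g (h + a / t)\<close>, so exchanging base point
  and direction reverses the coefficients. Top coefficients thereby become the value and the
  derivative of \<open>g\<close> at \<open>h\<close>.\<close>

lemma coeff_line_restriction_swap:
  assumes g: "g \<in> homogeneous_polynomials i" and "k \<le> i"
  shows "coeff (line_restriction g a h) k = coeff (line_restriction g h a) (i - k)"
proof -
  let ?p = "line_restriction g h a"
  let ?r = "\<Sum>k\<le>i. monom (coeff ?p (i - k)) k"
  note gp = homogeneous_imp_polynomial[OF g]
  have "poly ?r t = g (a + t *s h)" if "t \<noteq> 0" for t
  proof -
    have "poly ?r t = (\<Sum>k\<le>i. coeff ?p (i - k) * t ^ k)"
      by (simp add: poly_sum poly_monom)
    also have "\<dots> = (\<Sum>k\<le>i. coeff ?p k * t ^ (i - k))"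
      by (rule sum.reindex_bij_witness[of _ "\<lambda>k. i - k" "\<lambda>k. i - k"]) auto
    also have "\<dots> = (\<Sum>k\<le>i. t ^ i * (coeff ?p k * inverse t ^ k))"
      using that by (intro sum.cong) (auto simp: power_diff field_simps)
    also have "\<dots> = t ^ i * poly ?p (inverse t)"
    proof -
      have "poly ?p x = (\<Sum>k\<le>i. coeff ?p k * x ^ k)" for x
        using degree_line_restriction_homogeneous[OF g, of h a]
        by (subst poly_altdef, intro sum.mono_neutral_left) (auto intro: coeff_eq_0)
      then show ?thesis by (simp add: sum_distrib_left)
    qed
    also have "\<dots> = g (t *s (h + inverse t *s a))"
      by (simp only: homogeneous_scale[OF g] poly_line_restriction[OF gp])
    also have "t *s (h + inverse t *s a) = a + t *s h"
      using that by (simp add: vec_eq_iff algebra_simps)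
    finally show ?thesis .
  qed
  then have "line_restriction g a h = ?r" by (rule line_restriction_eqI[OF gp])
  then show ?thesis using assms(2) by (simp add: coeff_sum)
qed

lemma coeff_0_line_restriction:
  assumes "g \<in> polynomial_functions"
  shows "coeff (line_restriction g a h) 0 = g a"
  using poly_line_restriction[OF assms, of a h 0] by (simp add: poly_0_coeff_0)

lemma coeff_line_restriction_top:
  assumes "g \<in> homogeneous_polynomials i"
  shows "coeff (line_restriction g a h) i = g h"
  by (simp add: coeff_line_restriction_swap[OF assms order_refl]
      coeff_0_line_restriction[OF homogeneous_imp_polynomial[OF assms]])

section \<open>Derivatives as linear coefficients\<close>

lemma has_field_derivative_along_line:
  assumes "g \<in> polynomial_functions"
  shows "((\<lambda>t. g (x + t *s h)) has_field_derivative coeff (line_restriction g x h) 1) (at 0)"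
proof -
  have "((\<lambda>t. poly (line_restriction g x h) t) has_field_derivative
      poly (pderiv (line_restriction g x h)) 0) (at 0)"
    by (rule poly_DERIV)
  then show ?thesis
    by (simp add: poly_line_restriction[OF assms] poly_0_coeff_0 coeff_pderiv)
qed

lemma partial_derivative_eq_coeff:
  assumes "g \<in> polynomial_functions"
  shows "partial_derivative i g x = coeff (line_restriction g x (axis i 1)) 1"
  unfolding partial_derivative_def
  by (rule DERIV_imp_deriv) (rule has_field_derivative_along_line[OF assms])

lemma coeff_1_line_restriction:
  assumes "g \<in> polynomial_functions"
  shows "coeff (line_restriction g x h) 1 = (\<Sum>i\<in>UNIV. h $ i * partial_derivative i g x)"
proof -
  \<comment> \<open>The gradient stays existential during the induction over the span; the
    directions \<open>axis i 1\<close> identify its entries afterwards.\<close>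
  have "\<exists>G. \<forall>h. ((\<lambda>t. g (x + t *s h)) has_field_derivative (\<Sum>i\<in>UNIV. h $ i * G i)) (at 0)"
    using assms unfolding polynomial_functions_def
  proof (induction rule: cfun.span_induct_alt)
    case base
    show ?case by (intro exI[of _ "\<lambda>_. 0"]) simp
  next
    case (step c b g)
    then obtain m G where m: "b = monomial_fun m"
      and G: "\<And>h. ((\<lambda>t. g (x + t *s h)) has_field_derivative (\<Sum>i\<in>UNIV. h $ i * G i)) (at 0)"
      by blast
    define B where "B i = of_nat (m i) * (x $ i) ^ (m i - 1) * (\<Prod>j\<in>UNIV - {i}. (x $ j) ^ m j)"
      for i
    have "((\<lambda>t. b (x + t *s h)) has_field_derivative (\<Sum>i\<in>UNIV. h $ i * B i)) (at 0)" for h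
    proof -
      have "((\<lambda>t. (x $ j + t * h $ j) ^ m j) has_field_derivative
          of_nat (m j) * (x $ j) ^ (m j - 1) * h $ j) (at 0)" for j
        by (auto intro!: derivative_eq_intros)
      from has_field_derivative_prod[OF this, of "\<lambda>j. j" UNIV] show ?thesis
        by (simp add: m monomial_fun_def B_def algebra_simps)
    qed
    then have "((\<lambda>t. ((\<lambda>x. c * b x) + g) (x + t *s h)) has_field_derivative
        (\<Sum>i\<in>UNIV. h $ i * (c * B i + G i))) (at 0)" for h
      unfolding plus_fun_def
      by (rule DERIV_cong[OF DERIV_add[OF DERIV_cmult G]])
        (simp add: sum.distrib sum_distrib_left algebra_simps)
    then show ?case by (intro exI[of _ "\<lambda>i. c * B i + G i"] allI)
  qed
  then obtain G where
    G: "\<And>h. ((\<lambda>t. g (x + t *s h)) has_field_derivative (\<Sum>i\<in>UNIV. h $ i * G i)) (at 0)"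
    by blast
  have "partial_derivative i g x = G i" for i
    using DERIV_imp_deriv[OF G[of "axis i 1"]]
    by (simp add: partial_derivative_def axis_def if_distrib[of "\<lambda>u. u * _"] cong: if_cong)
  then show ?thesis
    using DERIV_unique[OF has_field_derivative_along_line[OF assms] G] by simp
qed

lemma continuous_polynomial_function:
  assumes "g \<in> polynomial_functions"
  shows "continuous_on UNIV g"
  using assms unfolding polynomial_functions_def
proof (induction rule: cfun.span_induct_alt)
  case base
  show ?case by (simp add: zero_fun_def)
next
  case (step c b g)
  then obtain m where "b = monomial_fun m" by blast
  then have "continuous_on UNIV b" unfolding monomial_fun_def by (simp, intro continuous_intros)
  then show ?case using step unfolding plus_fun_def by (intro continuous_intros)
qed

section \<open>The dimension of the space of homogeneous polynomials\<close>

text \<open>Monomials are distinct characters of the multiplicative monoid of vectors, so Dedekind's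
  argument for the independence of characters applies.\<close>

lemma monomials_linearly_independent:
  assumes "finite S" "\<And>x. (\<Sum>m\<in>S. c m * monomial_fun m x) = 0" "m \<in> S"
  shows "c m = 0"
  using assms
proof (induction S arbitrary: c m rule: finite_induct)
  case (insert k S)
  let ?mul = "\<lambda>x y :: complex ^ 'a. \<chi> j. x $ j * y $ j"
  have mul: "monomial_fun m (?mul x y) = monomial_fun m x * monomial_fun m y"
    for m :: "'a \<Rightarrow> nat" and x y
    by (simp add: monomial_fun_def power_mult_distrib prod.distrib)
  have S0: "c m = 0" if "m \<in> S" for m
  proof -
    from that insert.hyps obtain j where j: "m j \<noteq> k j" by (metis ext)
    define y :: "complex ^ 'a" where "y = (\<chi> i. if i = j then 2 else 1)"
    have y: "monomial_fun l y = 2 ^ l j" for l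
      by (simp add: monomial_fun_def y_def if_distrib[of "\<lambda>u. u ^ _"] cong: if_cong)
    \<comment> \<open>Evaluating the relation at the product of \<open>x\<close> and
      \<open>y\<close> and subtracting \<open>monomial_fun k y\<close> times the relation at
      \<open>x\<close> eliminates the term of \<open>k\<close>. The coefficient of \<open>m\<close>
      survives because \<open>y\<close> has the entry 2 at \<open>j\<close>, where \<open>m\<close>
      and \<open>k\<close> differ.\<close>
    have "(\<Sum>l\<in>S. (c l * (monomial_fun l y - monomial_fun k y)) * monomial_fun l x) = 0" for x
    proof -
      have "(\<Sum>l\<in>S. (c l * (monomial_fun l y - monomial_fun k y)) * monomial_fun l x) =
        (\<Sum>l\<in>insert k S. c l * monomial_fun l (?mul x y)) -
          monomial_fun k y * (\<Sum>l\<in>insert k S. c l * monomial_fun l x)"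
        using insert.hyps
        by (simp add: mul sum_distrib_left algebra_simps sum_subtractf)
      then show ?thesis using insert.prems(1)[of x] insert.prems(1)[of "?mul x y"] by simp
    qed
    from insert.IH[OF this that] have "c m * (monomial_fun m y - monomial_fun k y) = 0" .
    moreover have "(2::complex) ^ m j \<noteq> 2 ^ k j"
    proof
      assume "(2::complex) ^ m j = 2 ^ k j"
      then have "of_nat (2 ^ m j) = (of_nat (2 ^ k j) :: complex)" by simp
      then have "(2::nat) ^ m j = 2 ^ k j" by (simp only: of_nat_eq_iff)
      then show False using j by simp
    qed
    ultimately show ?thesis by (simp add: y)
  qed
  have "monomial_fun k (\<chi> j. 1) = 1" by (simp add: monomial_fun_def)
  then have "c k = 0"
    using insert.prems(1)[of "\<chi> j. 1"] insert.hyps S0 by simp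
  then show ?case using S0 insert.prems(2) by auto
qed simp

lemma inj_monomial_fun: "inj (monomial_fun :: ('n::finite \<Rightarrow> nat) \<Rightarrow> _)"
proof
  fix m k :: "'n \<Rightarrow> nat"
  assume eq: "monomial_fun m = monomial_fun k"
  show "m = k"
  proof (rule ccontr)
    assume "m \<noteq> k"
    then have "(1::complex) = 0"
      using eq monomials_linearly_independent[of "{m, k}" "\<lambda>l. if l = m then 1 else -1" m]
      by auto
    then show False by simp
  qed
qed

text \<open>An enumeration of the index type turns exponents into lists of length
  \<open>CARD('n)\<close> with sum \<open>i\<close>, which are counted by stars and bars.\<close>

lemma card_exponents:
  "finite {m :: 'n::finite \<Rightarrow> nat. sum m UNIV = i}"
  "card {m :: 'n::finite \<Rightarrow> nat. sum m UNIV = i} = (CARD('n) + i - 1) choose i"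
proof -
  obtain xs :: "'n list" where xs: "set xs = UNIV" "distinct xs"
    using finite_distinct_list[of "UNIV :: 'n set"] by auto
  then have len: "length xs = CARD('n)" by (metis distinct_card)
  let ?L = "{l :: nat list. length l = CARD('n) \<and> sum_list l = i}"
  have bij: "bij_betw (\<lambda>m. map m xs) {m. sum m UNIV = i} ?L"
  proof (rule bij_betwI')
    show "(map m xs = map k xs) = (m = k)" for m k using xs by (auto simp: fun_eq_iff)
    show "map m xs \<in> ?L" if "m \<in> {m. sum m UNIV = i}" for m
      using that xs len by (simp add: sum_list_distinct_conv_sum_set)
  next
    fix l assume l: "l \<in> ?L"
    define m where "m x = the (map_of (zip xs l) x)" for x
    have "map m xs = l"
      using l len xs(2) by (intro nth_equalityI) (auto simp: m_def map_of_zip_nth)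
    moreover from this have "sum m UNIV = i"
      using xs l sum_list_distinct_conv_sum_set[of xs m] by simp
    ultimately show "\<exists>m\<in>{m. sum m UNIV = i}. l = map m xs" by blast
  qed
  have "finite ?L"
  proof (rule finite_subset)
    show "?L \<subseteq> {l. set l \<subseteq> {..i} \<and> length l = CARD('n)}"
      using member_le_sum_list by fastforce
    show "finite {l. set l \<subseteq> {..i} \<and> length l = CARD('n)}"
      by (rule finite_lists_length_eq) simp
  qed
  then show "finite {m :: 'n::finite \<Rightarrow> nat. sum m UNIV = i}"
    using bij_betw_finite[OF bij] by simp
  show "card {m :: 'n::finite \<Rightarrow> nat. sum m UNIV = i} = (CARD('n) + i - 1) choose i"
    using bij_betw_same_card[OF bij] by (simp add: card_length_sum_list add.commute)
qed

lemma sum_fun_apply: "(\<Sum>i\<in>A. F i) x = (\<Sum>i\<in>A. F i x)"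
  by (induction A rule: infinite_finite_induct) auto

lemma homogeneous_basis:
  fixes i :: nat
  defines "M \<equiv> {monomial_fun m | m :: 'n::finite \<Rightarrow> nat. sum m UNIV = i}"
  shows "finite M" "cfun.independent M" "card M = (CARD('n) + i - 1) choose i"
proof -
  have M: "M = monomial_fun ` {m. sum m UNIV = i}" by (auto simp: M_def)
  show fin: "finite M" unfolding M by (rule finite_imageI[OF card_exponents(1)])
  show "card M = (CARD('n) + i - 1) choose i"
    unfolding M card_exponents(2)[symmetric]
    by (intro card_image inj_on_subset[OF inj_monomial_fun]) auto
  show "cfun.independent M"
  proof (rule cfun.independent_if_scalars_zero[OF fin])
    fix c g
    assume 0: "(\<Sum>b\<in>M. (\<lambda>x. c b * b x)) = 0" and "g \<in> M"
    then obtain m where m: "g = monomial_fun m" "sum m UNIV = i" by (auto simp: M_def)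
    have "(\<Sum>m | sum m UNIV = i. c (monomial_fun m) * monomial_fun m x) = 0" for x
    proof -
      have "(\<Sum>b\<in>M. c b * b x) = 0"
        using fun_cong[OF 0, of x] by (simp add: sum_fun_apply)
      then show ?thesis unfolding M
        by (subst (asm) sum.reindex) (auto intro: inj_on_subset[OF inj_monomial_fun])
    qed
    from monomials_linearly_independent[OF card_exponents(1) this] m
    show "c g = 0" by simp
  qed
qed

section \<open>Perturbation of roots\<close>

text \<open>The norm of \<open>poly q t\<close> is that of the leading coefficient times the product
  of the distances from \<open>t\<close> to the roots. If all of these were at least \<delta>, the
  value would be too large.\<close>

lemma complex_poly_root_near:
  fixes q :: "complex poly"
  assumes "0 < \<delta>" "norm (poly q t) < norm (lead_coeff q) * \<delta> ^ degree q"
  obtains z where "poly q z = 0" "dist t z < \<delta>"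
proof -
  obtain root where q: "smult (lead_coeff q) (\<Prod>i<degree q. [:-root i, 1:]) = q"
    by (rule complex_poly_decompose')
  have poly_q: "poly q x = lead_coeff q * (\<Prod>i<degree q. x - root i)" for x
    by (subst q[symmetric]) (simp add: poly_prod)
  have "\<exists>i<degree q. dist t (root i) < \<delta>"
  proof (rule ccontr)
    assume "\<not> ?thesis"
    then have "\<delta> \<le> norm (t - root i)" if "i < degree q" for i
      using that by (metis dist_norm not_less)
    then have "(\<Prod>i<degree q. \<delta>) \<le> (\<Prod>i<degree q. norm (t - root i))"
      using assms(1) by (intro prod_mono) auto
    then have "norm (lead_coeff q) * \<delta> ^ degree q \<le> norm (poly q t)"
      by (simp add: poly_q norm_mult prod_norm mult_left_mono)
    with assms(2) show False by simp
  qed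
  then obtain i where "i < degree q" "dist t (root i) < \<delta>" by blast
  moreover from this have "poly q (root i) = 0" by (auto simp: poly_q)
  ultimately show ?thesis using that by blast
qed

lemma rsquarefree_card_roots:
  fixes p :: "complex poly"
  assumes "rsquarefree p"
  shows "card {z. poly p z = 0} = degree p"
proof -
  have "p \<noteq> 0" using assms by (simp add: rsquarefree_def)
  have "degree p = degree (smult (lead_coeff p) (\<Prod>z | poly p z = 0. [:-z, 1:]))"
    using complex_poly_decompose_rsquarefree[OF assms] by simp
  also have "\<dots> = card {z. poly p z = 0}"
    using \<open>p \<noteq> 0\<close> by (simp add: degree_prod_eq_sum_degree)
  finally show ?thesis by simp
qed

text \<open>The \<delta>-balls around the points of \<open>T\<close> are disjoint, so roots found in
  different balls are different.\<close>

lemma finite_set_separated: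
  fixes T :: "'a::metric_space set"
  assumes "finite T"
  obtains \<delta> where "0 < \<delta>" "\<And>s t. s \<in> T \<Longrightarrow> t \<in> T \<Longrightarrow> s \<noteq> t \<Longrightarrow> 2 * \<delta> \<le> dist s t"
proof
  let ?D = "(\<lambda>(s, t). dist s t / 2) ` {(s, t) \<in> T \<times> T. s \<noteq> t}"
  have fin: "finite ?D"
    by (rule finite_imageI, rule finite_subset[of _ "T \<times> T"]) (use assms in auto)
  \<comment> \<open>The element 1 covers sets \<open>T\<close> with fewer than two points, where
    \<open>?D\<close> is empty.\<close>
  show "0 < Min (insert 1 ?D)"
    by (subst Min_gr_iff) (use fin in \<open>auto simp del: Min_insert\<close>)
  show "2 * Min (insert 1 ?D) \<le> dist s t" if "s \<in> T" "t \<in> T" "s \<noteq> t" for s t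
  proof -
    have "Min (insert 1 ?D) \<le> dist s t / 2" using that fin by (intro Min_le) auto
    then show ?thesis by simp
  qed
qed

text \<open>The number of distinct roots cannot drop in the limit. The degree is eventually exactly
  \<open>N\<close>, with leading coefficient of norm above \<open>norm l / 2\<close>, while the
  values at \<open>T\<close> tend to 0; hence each point of \<open>T\<close> acquires a root within
  the separating radius.\<close>

lemma eventually_card_roots_ge:
  fixes q :: "'a \<Rightarrow> complex poly"
  assumes T: "finite T" and deg: "\<And>x. degree (q x) \<le> N"
    and lc: "((\<lambda>x. coeff (q x) N) \<longlongrightarrow> l) F" "l \<noteq> 0"
    and lim: "\<And>t. t \<in> T \<Longrightarrow> ((\<lambda>x. poly (q x) t) \<longlongrightarrow> 0) F"
  shows "eventually (\<lambda>x. card T \<le> card {z. poly (q x) z = 0}) F"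
proof -
  obtain \<delta> where \<delta>: "0 < \<delta>" "\<And>s t. s \<in> T \<Longrightarrow> t \<in> T \<Longrightarrow> s \<noteq> t \<Longrightarrow> 2 * \<delta> \<le> dist s t"
    using finite_set_separated[OF T] by blast
  have "eventually (\<lambda>x. norm l / 2 < norm (coeff (q x) N)) F"
    using lc by (intro order_tendstoD(1)[OF tendsto_norm[OF lc(1)]]) auto
  moreover have "eventually (\<lambda>x. \<forall>t\<in>T. norm (poly (q x) t) < norm l / 2 * \<delta> ^ N) F"
  proof (intro eventually_ball_finite[OF T] ballI)
    fix t assume "t \<in> T"
    from order_tendstoD(2)[OF tendsto_norm_zero[OF lim[OF this]], of "norm l / 2 * \<delta> ^ N"]
    show "eventually (\<lambda>x. norm (poly (q x) t) < norm l / 2 * \<delta> ^ N) F"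
      using lc \<delta> by simp
  qed
  ultimately show ?thesis
  proof eventually_elim
    case (elim x)
    from elim(1) have "coeff (q x) N \<noteq> 0" using norm_ge_zero[of l] by (auto simp del: norm_ge_zero)
    then have N: "degree (q x) = N" and q0: "q x \<noteq> 0"
      using deg[of x] le_degree[of "q x" N] by auto
    have "\<exists>z. poly (q x) z = 0 \<and> dist t z < \<delta>" if "t \<in> T" for t
    proof -
      have "norm (poly (q x) t) < norm (coeff (q x) N) * \<delta> ^ N"
        using elim that \<delta>(1) by (smt (verit) mult_right_mono zero_le_power)
      then show ?thesis using complex_poly_root_near[OF \<delta>(1), of "q x" t] N by metis
    qed
    then obtain z where z: "\<And>t. t \<in> T \<Longrightarrow> poly (q x) (z t) = 0 \<and> dist t (z t) < \<delta>" by metis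
    show ?case
    proof (rule card_inj_on_le)
      show "finite {z. poly (q x) z = 0}" using poly_roots_finite[OF q0] .
      show "z ` T \<subseteq> {z. poly (q x) z = 0}" using z by auto
      show "inj_on z T"
      proof
        fix s t assume st: "s \<in> T" "t \<in> T" "z s = z t"
        show "s = t"
        proof (rule ccontr)
          assume "s \<noteq> t"
          then have "2 * \<delta> \<le> dist s t" using \<delta>(2) st by blast
          also have "\<dots> \<le> dist s (z s) + dist t (z t)" using st(3) by (metis dist_triangle2)
          finally show False using z[OF st(1)] z[OF st(2)] by simp
        qed
      qed
    qed
  qed
qed

section \<open>Limits of polynomial functions and vectors\<close>

lemma tendsto_polynomial_function:
  assumes "g \<in> polynomial_functions" "(u \<longlongrightarrow> x) F"
  shows "((\<lambda>s. g (u s)) \<longlongrightarrow> g x) F"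
  using continuous_on_tendsto_compose[OF continuous_polynomial_function[OF assms(1)] assms(2)]
  by simp

lemma tendsto_vector_scalar_mult:
  fixes v :: "complex ^ 'n::finite"
  assumes "(u \<longlongrightarrow> c) F"
  shows "((\<lambda>s. u s *s v) \<longlongrightarrow> c *s v) F"
  by (rule vec_tendstoI) (simp, intro tendsto_intros assms)

lemma vector_scalar_mult_tendsto:
  fixes u :: "'a \<Rightarrow> complex ^ 'n::finite"
  assumes "(u \<longlongrightarrow> v) F"
  shows "((\<lambda>s. c *s u s) \<longlongrightarrow> c *s v) F"
  by (rule vec_tendstoI) (simp, intro tendsto_mult_left tendsto_vec_nth assms)

section \<open>Transversal lines\<close>

text \<open>The intersection at \<open>p\<close> is multiple, so after one factor \<open>t\<close>
  is divided out, 0 is still a root in the limit. All points of the old intersection thus yield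
  roots of the quotient on the tilted line; none of these is 0, and the intersection at
  \<open>p\<close> itself is one more.\<close>

lemma tilted_line_more_roots:
  assumes f: "f \<in> homogeneous_polynomials d" and "d > 0"
    and p: "f p = 0" "p \<noteq> 0" "partial_derivative i f p \<noteq> 0"
    and e: "f e \<noteq> 0" "coeff (line_restriction f p e) 1 = 0"
    and fin: "finite {t. f (p + t *s e) = 0}"
  obtains e' where "f e' \<noteq> 0" "\<And>t. p + t *s e' \<noteq> 0"
    "card {t. f (p + t *s e) = 0} < card {t. f (p + t *s e') = 0}"
proof -
  note fp = homogeneous_imp_polynomial[OF f]
  let ?T = "{t. f (p + t *s e) = 0}"
  define u where "u \<epsilon> = e + \<epsilon> *s axis i 1" for \<epsilon>
  define L where "L \<epsilon> = line_restriction f p (u \<epsilon>)" for \<epsilon>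
  \<comment> \<open>Since \<open>f p = 0\<close>, the restriction to the tilted line has no constant
    term, and \<open>s\<close> is its quotient by \<open>t\<close>.\<close>
  define s where "s \<epsilon> = poly_shift 1 (L \<epsilon>)" for \<epsilon>
  have L: "L \<epsilon> = pCons 0 (s \<epsilon>)" for \<epsilon>
    by (rule poly_eqI)
      (auto simp: s_def coeff_poly_shift coeff_pCons L_def coeff_0_line_restriction[OF fp] p
        split: nat.split)
  have poly_s: "f (p + t *s u \<epsilon>) = t * poly (s \<epsilon>) t" for t \<epsilon>
    using poly_line_restriction[OF fp, of p "u \<epsilon>" t] L[of \<epsilon>] by (simp add: L_def)
  have s0: "poly (s \<epsilon>) 0 = \<epsilon> * partial_derivative i f p" for \<epsilon>
  proof -
    have "poly (s \<epsilon>) 0 = coeff (L \<epsilon>) 1" by (simp add: L poly_0_coeff_0)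
    also have "\<dots> = coeff (line_restriction f p e) 1 +
        (\<Sum>j\<in>UNIV. \<epsilon> * axis i 1 $ j * partial_derivative j f p)"
      unfolding L_def coeff_1_line_restriction[OF fp] u_def
      by (simp add: distrib_right sum.distrib)
    also have "\<dots> = \<epsilon> * partial_derivative i f p"
      using e by (simp add: axis_def if_distrib[of "\<lambda>u. _ * u * _"] cong: if_cong)
    finally show ?thesis .
  qed
  have u: "(u \<longlongrightarrow> e) (at 0)"
  proof -
    have "((\<lambda>\<epsilon>. e + \<epsilon> *s axis i 1) \<longlongrightarrow> e + 0 *s axis i 1) (at 0)"
      by (intro tendsto_intros tendsto_vector_scalar_mult)
    then show ?thesis by (simp add: u_def[abs_def])
  qed
  have lc: "((\<lambda>\<epsilon>. f (u \<epsilon>)) \<longlongrightarrow> f e) (at 0)"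
    by (rule tendsto_polynomial_function[OF fp u])
  have "eventually (\<lambda>\<epsilon>. card ?T \<le> card {z. poly (s \<epsilon>) z = 0}) (at 0)"
  proof (rule eventually_card_roots_ge[OF fin])
    show "degree (s \<epsilon>) \<le> d - 1" for \<epsilon>
      using degree_line_restriction_homogeneous[OF f, of p "u \<epsilon>"] \<open>d > 0\<close>
      by (intro degree_le) (auto simp: s_def coeff_poly_shift L_def intro!: coeff_eq_0)
    have "coeff (s \<epsilon>) (d - 1) = f (u \<epsilon>)" for \<epsilon>
      using \<open>d > 0\<close> coeff_line_restriction_top[OF f, of p "u \<epsilon>"]
      by (simp add: s_def coeff_poly_shift L_def)
    then show "((\<lambda>\<epsilon>. coeff (s \<epsilon>) (d - 1)) \<longlongrightarrow> f e) (at 0)" using lc by simp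
    show "((\<lambda>\<epsilon>. poly (s \<epsilon>) t) \<longlongrightarrow> 0) (at 0)" if "t \<in> ?T" for t
    proof (cases "t = 0")
      \<comment> \<open>Here the multiplicity enters: by \<open>s0\<close> the value at 0 is
        proportional to \<epsilon>.\<close>
      case True
      show ?thesis unfolding True s0 by (rule tendsto_mult_left_zero[OF tendsto_ident_at])
    next
      case False
      have "((\<lambda>\<epsilon>. f (p + t *s u \<epsilon>) / t) \<longlongrightarrow> f (p + t *s e) / t) (at 0)"
        by (intro tendsto_divide tendsto_const tendsto_polynomial_function[OF fp] tendsto_add
            vector_scalar_mult_tendsto u False)
      then show ?thesis using False that by (simp add: poly_s)
    qed
  qed (rule e(1))
  moreover have "eventually (\<lambda>\<epsilon>. f (u \<epsilon>) \<noteq> 0) (at 0)"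
    by (rule tendsto_imp_eventually_ne[OF lc e(1)])
  moreover have "eventually (\<lambda>\<epsilon>::complex. \<epsilon> \<noteq> 0) (at 0)" by (rule eventually_neq_at_within)
  ultimately have "eventually (\<lambda>\<epsilon>. card ?T \<le> card {z. poly (s \<epsilon>) z = 0} \<and> f (u \<epsilon>) \<noteq> 0 \<and> \<epsilon> \<noteq> 0) (at 0)"
    by eventually_elim auto
  then obtain \<epsilon> where \<epsilon>: "card ?T \<le> card {z. poly (s \<epsilon>) z = 0}" "f (u \<epsilon>) \<noteq> 0" "\<epsilon> \<noteq> 0"
    using eventually_happens'[OF at_neq_bot] by blast
  have nz: "poly (s \<epsilon>) 0 \<noteq> 0" using s0 p \<epsilon> by simp
  then have "finite {z. poly (s \<epsilon>) z = 0}" by (intro poly_roots_finite) auto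
  moreover have "{t. f (p + t *s u \<epsilon>) = 0} = insert 0 {z. poly (s \<epsilon>) z = 0}"
    by (auto simp: poly_s p)
  ultimately have "card ?T < card {t. f (p + t *s u \<epsilon>) = 0}" using nz \<epsilon>(1) by simp
  \<comment> \<open>A line through \<open>p\<close> and the origin would make \<open>p\<close> a
    multiple of its direction, where \<open>f\<close> does not vanish; \<open>f p = 0\<close> then
    forces \<open>p = 0\<close>.\<close>
  moreover have "p + t *s u \<epsilon> \<noteq> 0" for t
  proof
    assume "p + t *s u \<epsilon> = 0"
    then have pt: "p = (- t) *s u \<epsilon>" by (simp add: eq_neg_iff_add_eq_0)
    then have "(- t) ^ d * f (u \<epsilon>) = 0" using p(1) homogeneous_scale[OF f] by metis
    then show False using \<epsilon>(2) pt p(2) by simp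
  qed
  ultimately show ?thesis using that \<epsilon>(2) by blast
qed

text \<open>As \<open>f e\<close> is the leading coefficient, the restriction has degree exactly
  \<open>d\<close>; with fewer than \<open>d\<close> roots it has a multiple one. The corresponding
  point \<open>p\<close> is not the origin, so smoothness supplies a transversal direction in which
  to tilt.\<close>

lemma line_more_roots:
  assumes f: "f \<in> homogeneous_polynomials d"
    and nonsing: "\<And>x. x \<noteq> 0 \<Longrightarrow> f x = 0 \<Longrightarrow> \<exists>i. partial_derivative i f x \<noteq> 0"
    and e: "f e \<noteq> 0" and a: "\<And>t. a + t *s e \<noteq> 0"
    and few: "card {t. f (a + t *s e) = 0} < d"
  obtains a' e' where "f e' \<noteq> 0" "\<And>t. a' + t *s e' \<noteq> 0"
    "card {t. f (a + t *s e) = 0} < card {t. f (a' + t *s e') = 0}"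
proof -
  note fp = homogeneous_imp_polynomial[OF f]
  define L where "L = line_restriction f a e"
  have poly_L: "poly L t = f (a + t *s e)" for t by (simp add: L_def poly_line_restriction[OF fp])
  have "coeff L d \<noteq> 0" using e by (simp add: L_def coeff_line_restriction_top[OF f])
  then have L0: "L \<noteq> 0" and deg: "degree L = d"
    using degree_line_restriction_homogeneous[OF f, of a e] le_degree[of L d] by (auto simp: L_def)
  have "\<not> rsquarefree L"
    using few rsquarefree_card_roots[of L] deg by (auto simp: poly_L)
  then obtain t0 where t0: "poly L t0 = 0" "poly (pderiv L) t0 = 0"
    using rsquarefree_roots by blast
  define p where "p = a + t0 *s e"
  have shift: "p + t *s e = a + (t0 + t) *s e" for t
    by (simp add: p_def vec_eq_iff algebra_simps)
  have fin: "finite {t. f (a + t *s e) = 0}" using poly_roots_finite[OF L0] by (simp add: poly_L)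
  have bij: "bij_betw (\<lambda>t. t0 + t) {t. f (p + t *s e) = 0} {t. f (a + t *s e) = 0}"
    by (rule bij_betw_byWitness[where f' = "\<lambda>t. t - t0"]) (auto simp: shift)
  have "((\<lambda>t. poly L (t0 + t)) has_field_derivative poly (pderiv L) t0 * (0 + 1)) (at 0)"
    by (intro DERIV_chain2[where g = "\<lambda>t. t0 + t"] DERIV_add DERIV_const DERIV_ident)
      (simp add: poly_DERIV)
  then have "coeff (line_restriction f p e) 1 = 0"
    using DERIV_unique[OF has_field_derivative_along_line[OF fp, of p e]] t0
    by (simp add: poly_L shift)
  moreover have "f p = 0" "p \<noteq> 0" using t0 a by (auto simp: p_def poly_L)
  moreover from this obtain i where "partial_derivative i f p \<noteq> 0" using nonsing by blast
  moreover have "finite {t. f (p + t *s e) = 0}" using bij_betw_finite[OF bij] fin by simp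
  ultimately obtain e' where "f e' \<noteq> 0" "\<And>t. p + t *s e' \<noteq> 0"
    "card {t. f (p + t *s e) = 0} < card {t. f (p + t *s e') = 0}"
    using tilted_line_more_roots[OF f, of p i e] few e by auto
  then show ?thesis using that bij_betw_same_card[OF bij] by auto
qed

text \<open>Repeated tilting reaches \<open>d\<close> intersection points. The induction also keeps
  the line away from the origin, because \<open>nonsing\<close> speaks of nonzero points
  only.\<close>

lemma transversal_line_exists:
  assumes f: "f \<in> homogeneous_polynomials d"
    and nonsing: "\<And>x. x \<noteq> 0 \<Longrightarrow> f x = 0 \<Longrightarrow> \<exists>i. partial_derivative i f x \<noteq> 0"
    and "f e\<^sub>0 \<noteq> 0" and "\<And>t. a\<^sub>0 + t *s e\<^sub>0 \<noteq> 0"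
  obtains a e where "f e \<noteq> 0" "d \<le> card {t. f (a + t *s e) = 0}"
proof -
  have "\<exists>a e. f e \<noteq> 0 \<and> (\<forall>t. a + t *s e \<noteq> 0) \<and> r \<le> card {t. f (a + t *s e) = 0}"
    if "r \<le> d" for r
    using that
  proof (induction r)
    case 0
    then show ?case using assms by auto
  next
    case (Suc r)
    then obtain a e where ae: "f e \<noteq> 0" "\<And>t. a + t *s e \<noteq> 0"
      "r \<le> card {t. f (a + t *s e) = 0}" by auto
    show ?case
    proof (cases "Suc r \<le> card {t. f (a + t *s e) = 0}")
      case False
      then have "card {t. f (a + t *s e) = 0} < d" using Suc.prems by simp
      from line_more_roots[OF f nonsing ae(1,2) this]
      obtain a' e' where "f e' \<noteq> 0" "\<And>t. a' + t *s e' \<noteq> 0"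
        "card {t. f (a + t *s e) = 0} < card {t. f (a' + t *s e') = 0}" by blast
      then show ?thesis using ae(3) by (intro exI[of _ a'] exI[of _ e']) auto
    qed (use ae in blast)
  qed
  then show ?thesis using that by blast
qed

section \<open>Forms of degree \<open>d\<close> vanishing on a smooth hypersurface\<close>

lemma vanishing_on_smooth_imp_multiple:
  assumes f: "f \<in> homogeneous_polynomials d" and g: "g \<in> homogeneous_polynomials d"
    and nonsing: "\<And>x. x \<noteq> 0 \<Longrightarrow> f x = 0 \<Longrightarrow> \<exists>i. partial_derivative i f x \<noteq> 0"
    and zeros: "\<And>x. x \<noteq> 0 \<Longrightarrow> f x = 0 \<Longrightarrow> g x = 0" and e\<^sub>0: "f e\<^sub>0 \<noteq> 0"
  shows "\<exists>c. g = (\<lambda>x. c * f x)"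
proof (cases "\<exists>a. \<forall>t. a + t *s e\<^sub>0 \<noteq> 0")
  \<comment> \<open>Every line of direction \<open>e\<^sub>0\<close> meets the origin, so the space
    is spanned by \<open>e\<^sub>0\<close> and both forms are determined by their values
    there.\<close>
  case False
  have "g x = g e\<^sub>0 / f e\<^sub>0 * f x" for x
  proof -
    obtain t where "x + t *s e\<^sub>0 = 0" using False by blast
    then have x: "x = (- t) *s e\<^sub>0" by (simp add: eq_neg_iff_add_eq_0)
    show ?thesis unfolding x homogeneous_scale[OF f] homogeneous_scale[OF g] using e\<^sub>0 by simp
  qed
  then show ?thesis by blast
next
  case True
  then obtain a e where e: "f e \<noteq> 0" and roots: "d \<le> card {t. f (a + t *s e) = 0}"
    using transversal_line_exists[OF f nonsing e\<^sub>0] by metis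
  note fp = homogeneous_imp_polynomial[OF f]
  \<comment> \<open>At the origin, \<open>f 0 = 0 ^ d * f e\<close> with
    \<open>f e \<noteq> 0\<close>; if this is 0, then \<open>d > 0\<close> and
    \<open>g 0 = 0\<close> as well.\<close>
  have zeros': "g x = 0" if "f x = 0" for x
  proof (cases "x = 0")
    case True
    then show ?thesis
      using that e homogeneous_scale[OF f, of 0 e] homogeneous_scale[OF g, of 0 e] by auto
  qed (use zeros that in blast)
  \<comment> \<open>With this factor the coefficient of \<open>t^d\<close> of \<open>g - c f\<close>
    vanishes on all lines of direction \<open>e\<close>. On such a line with \<open>d\<close> zeros
    of \<open>f\<close>, the difference has more zeros than its degree allows unless it is
    0.\<close>
  define c where "c = g e / f e"
  define G where "G x = g x - c * f x" for x
  have "G = g - (\<lambda>x. c * f x)" by (auto simp: G_def)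
  then have G: "G \<in> homogeneous_polynomials d"
    using f g unfolding homogeneous_polynomials_def
    by (simp only:) (intro cfun.span_diff cfun.span_scale)
  note Gp = homogeneous_imp_polynomial[OF G]
  have G_zero: "G x = 0" if "d \<le> card {t. f (x + t *s e) = 0}" for x
  proof -
    let ?P = "line_restriction G x e"
    have "?P = 0"
    proof (rule ccontr)
      assume P0: "?P \<noteq> 0"
      have "d \<le> card {t. poly ?P t = 0}"
        using that poly_roots_finite[OF P0]
        by (elim order_trans, intro card_mono)
          (auto simp: poly_line_restriction[OF Gp] G_def zeros')
      also have "\<dots> \<le> degree ?P" by (rule card_poly_roots_bound[OF P0])
      finally have "degree ?P = d" using degree_line_restriction_homogeneous[OF G, of x e] by simp
      moreover have "coeff ?P d = 0"
        using e by (simp add: coeff_line_restriction_top[OF G] G_def c_def)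
      ultimately show False using P0 by (metis leading_coeff_0_iff)
    qed
    then show ?thesis using coeff_0_line_restriction[OF Gp, of x e] by simp
  qed
  \<comment> \<open>Move the base point from \<open>a\<close> towards \<open>b\<close>. For small
    \<open>s\<close> the parallel line still has \<open>d\<close> zeros of \<open>f\<close>, so
    \<open>G\<close> vanishes at its base point. A polynomial in \<open>s\<close> vanishing near 0
    is zero, and \<open>s = 1\<close> gives \<open>b\<close>.\<close>
  have "G b = 0" for b
  proof -
    let ?u = "\<lambda>s. a + s *s (b - a)"
    let ?P = "line_restriction G a (b - a)"
    let ?R = "{t. f (a + t *s e) = 0}"
    have "coeff (line_restriction f a e) d \<noteq> 0"
      using e by (simp add: coeff_line_restriction_top[OF f])
    then have "line_restriction f a e \<noteq> 0" by auto
    then have fin: "finite ?R"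
      using poly_roots_finite by (force simp: poly_line_restriction[OF fp])
    have "eventually (\<lambda>s. card ?R \<le> card {z. poly (line_restriction f (?u s) e) z = 0}) (at 0)"
    proof (rule eventually_card_roots_ge[OF fin])
      show "degree (line_restriction f (?u s) e) \<le> d" for s
        by (rule degree_line_restriction_homogeneous[OF f])
      show "((\<lambda>s. coeff (line_restriction f (?u s) e) d) \<longlongrightarrow> f e) (at 0)"
        by (simp add: coeff_line_restriction_top[OF f])
      show "((\<lambda>s. poly (line_restriction f (?u s) e) t) \<longlongrightarrow> 0) (at 0)" if "t \<in> ?R" for t
      proof -
        have "((\<lambda>s. f (?u s + t *s e)) \<longlongrightarrow> f (?u 0 + t *s e)) (at 0)"
          by (intro tendsto_polynomial_function[OF fp] tendsto_intros tendsto_vector_scalar_mult)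
        then show ?thesis using that by (simp add: poly_line_restriction[OF fp])
      qed
    qed (rule e)
    then have ev: "eventually (\<lambda>s. poly ?P s = 0) (at 0)"
    proof eventually_elim
      case (elim s)
      then have "d \<le> card {t. f (?u s + t *s e) = 0}"
        using roots by (simp add: poly_line_restriction[OF fp])
      then show ?case by (simp add: poly_line_restriction[OF Gp] G_zero)
    qed
    have "?P = 0"
    proof (rule ccontr)
      assume "?P \<noteq> 0"
      then have "\<not> 0 islimpt {z. poly ?P z = 0}"
        by (intro islimpt_finite poly_roots_finite)
      then have "eventually (\<lambda>s. poly ?P s \<noteq> 0) (at 0)"
        by (simp add: islimpt_iff_eventually)
      with ev have "eventually (\<lambda>s::complex. False) (at 0)" by eventually_elim simp
      then show False by (simp add: eventually_False)
    qed
    then show ?thesis using poly_line_restriction[OF Gp, of a "b - a" 1] by simp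
  qed
  then have "g = (\<lambda>x. c * f x)" by (auto simp: G_def fun_eq_iff)
  then show ?thesis by blast
qed

section \<open>The inverse system\<close>

lemma degree_line_restriction_le_rho:
  assumes "f \<in> polynomial_functions"
  shows "degree (line_restriction f a h) \<le> rho f h"
  unfolding rho_def by (intro Max_ge finite_line_degrees[OF assms]) auto

lemma rho_le_iff:
  assumes "f \<in> polynomial_functions"
  shows "rho f h \<le> k \<longleftrightarrow> (\<forall>a. degree (line_restriction f a h) \<le> k)"
  unfolding rho_def by (subst Max_le_iff) (auto simp: finite_line_degrees[OF assms])

text \<open>Exchanging base point and direction turns this into the derivative of \<open>f\<close>
  at \<open>h\<close> in the direction \<open>a\<close>.\<close>

lemma coeff_line_restriction_pred:
  assumes "f \<in> homogeneous_polynomials d" "d > 0"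
  shows "coeff (line_restriction f a h) (d - 1) = (\<Sum>i\<in>UNIV. a $ i * partial_derivative i f h)"
  using assms coeff_line_restriction_swap[OF assms(1), of "d - 1" a h]
  by (simp add: coeff_1_line_restriction[OF homogeneous_imp_polynomial] del: One_nat_def)

text \<open>\<open>smooth_hypersurface\<close> speaks of all representatives of a projective point.
  Under scaling by \<open>c \<noteq> 0\<close> the partial derivatives are multiplied by
  \<open>c ^ d / c\<close>, so their vanishing at one representative carries over to all.\<close>

lemma smooth_hypersurface_partial_derivative:
  assumes f: "f \<in> homogeneous_polynomials d" and "smooth_hypersurface f" "x \<noteq> 0" "f x = 0"
  shows "\<exists>i. partial_derivative i f x \<noteq> 0"
proof (rule ccontr)
  assume "\<not> ?thesis"
  then have 0: "partial_derivative i f x = 0" for i by blast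
  note fp = homogeneous_imp_polynomial[OF f]
  have "f y = 0 \<and> (\<forall>i. partial_derivative i f y = 0)" if y: "y \<in> vec.span {x} - {0}" for y
  proof -
    from y obtain c where c: "y = c *s x" "c \<noteq> 0" by (auto simp: vec.span_singleton)
    have scale: "f (y + t *s h) = c ^ d * f (x + (t / c) *s h)" for t h
    proof -
      have "y + t *s h = c *s (x + (t / c) *s h)" using c by (simp add: vec_eq_iff algebra_simps)
      then show ?thesis by (simp only: homogeneous_scale[OF f])
    qed
    have deriv: "((\<lambda>t. c ^ d * f (x + (t / c) *s axis i 1)) has_field_derivative
        c ^ d * (coeff (line_restriction f x (axis i 1)) 1 * (1 / c))) (at 0)" for i
      using has_field_derivative_along_line[OF fp, of x "axis i 1"] c(2)
      by (intro DERIV_cmult DERIV_chain2[where g = "\<lambda>t. t / c"])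
        (auto intro!: derivative_eq_intros)
    have "partial_derivative i f y = 0" for i
      using DERIV_imp_deriv[OF deriv[of i]] 0[of i]
      unfolding partial_derivative_def[of i f y] scale partial_derivative_eq_coeff[OF fp, of i x]
      by simp
    then show ?thesis using assms(4) c by (simp add: homogeneous_scale[OF f])
  qed
  moreover have "vec.span {x} \<in> projective_space" using assms(3) by (auto simp: projective_space_def)
  ultimately show False using assms(2) unfolding smooth_hypersurface_def by blast
qed

text \<open>The coefficient of \<open>t^i\<close> on any line of direction \<open>x\<close> is
  \<open>g x\<close>, and the degree bound excludes it.\<close>

lemma inverse_system_vanish:
  assumes g: "g \<in> inverse_system \<rho>" "g \<in> homogeneous_polynomials i" and "x \<noteq> 0" "\<rho> x < i"
  shows "g x = 0"
proof -
  have "degree (line_restriction g 0 x) < i"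
    using g(1) assms(3,4) unfolding inverse_system_def by (auto intro: le_less_trans)
  then show ?thesis using coeff_line_restriction_top[OF g(2), of 0 x] by (simp add: coeff_eq_0)
qed

lemma inverse_system_degree_gt:
  assumes f: "f \<in> homogeneous_polynomials d" and i: "i > d"
    and g: "g \<in> inverse_system (rho f) \<inter> homogeneous_polynomials i"
  shows "g = 0"
proof
  fix h
  have gi: "g \<in> homogeneous_polynomials i" using g by simp
  show "g h = 0 h"
  proof (cases "h = 0")
    case True
    then show ?thesis using homogeneous_scale[OF gi, of 0 0] i by (simp add: power_0_left)
  next
    case False
    have "rho f h \<le> d"
      using degree_line_restriction_homogeneous[OF f]
      by (simp add: rho_le_iff[OF homogeneous_imp_polynomial[OF f]])
    then show ?thesis using inverse_system_vanish[OF _ gi False, of "rho f"] g i by simp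
  qed
qed

section \<open>The Hilbert function of a smooth hypersurface\<close>

lemma smooth_imp_dim_inverse_system:
  fixes f :: "complex ^ 'n::finite \<Rightarrow> complex"
  assumes f: "f \<in> homogeneous_polynomials d" and f0: "f \<noteq> (\<lambda>x. 0)"
    and smooth: "smooth_hypersurface f"
  shows "cfun.dim (inverse_system (rho f) \<inter> homogeneous_polynomials i) =
    (if i < d then (CARD('n) + i - 1) choose i else if i = d then 1 else 0)"
proof -
  note fp = homogeneous_imp_polynomial[OF f]
  note nonsing = smooth_hypersurface_partial_derivative[OF f smooth]
  let ?C = "inverse_system (rho f) \<inter> homogeneous_polynomials i"
  have rho_ge: "d - 1 \<le> rho f h" if h: "h \<noteq> 0" for h
  proof (cases "f h = 0 \<and> d > 0")
    case False
    then consider "d = 0" | "coeff (line_restriction f 0 h) d \<noteq> 0"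
      using coeff_line_restriction_top[OF f, of 0 h] by auto
    then show ?thesis
    proof cases
      case 2
      then have "d \<le> rho f h"
        using degree_line_restriction_le_rho[OF fp] le_degree order_trans by blast
      then show ?thesis by simp
    qed simp
  next
    case True
    \<comment> \<open>On the hypersurface the base point \<open>axis j 1\<close> makes the
      coefficient of \<open>t^(d-1)\<close> equal to the partial derivative with index
      \<open>j\<close> at \<open>h\<close>.\<close>
    then obtain j where "partial_derivative j f h \<noteq> 0" using nonsing[OF h] by blast
    then have "coeff (line_restriction f (axis j 1) h) (d - 1) \<noteq> 0"
      using True unfolding coeff_line_restriction_pred[OF f conjunct2[OF True]]
      by (simp add: axis_def if_distrib[of "\<lambda>u. u * _"] cong: if_cong)
    then show ?thesis
      using degree_line_restriction_le_rho[OF fp] le_degree order_trans by blast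
  qed
  consider "i < d" | "i = d" | "i > d" by linarith
  then show ?thesis
  proof cases
    case 1
    \<comment> \<open>Below degree \<open>d\<close> the bound \<open>d - 1 \<le> rho f h\<close>
      imposes no condition.\<close>
    have "?C = homogeneous_polynomials i"
    proof -
      have "g \<in> inverse_system (rho f)" if "g \<in> homogeneous_polynomials i" for g
        unfolding inverse_system_def
      proof (intro CollectI conjI allI impI homogeneous_imp_polynomial[OF that])
        fix h a :: "complex ^ 'n" assume "h \<noteq> 0"
        then show "degree (line_restriction g a h) \<le> rho f h"
          using degree_line_restriction_homogeneous[OF that, of a h] rho_ge[of h] 1 by linarith
      qed
      then show ?thesis by blast
    qed
    then show ?thesis
      using 1 homogeneous_basis(2,3)[where 'n = 'n, of i]
      by (simp add: homogeneous_polynomials_def cfun.dim_eq_card_independent)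
  next
    case 2
    obtain e where e: "f e \<noteq> 0" using f0 by auto
    have "?C = cfun.span {f}"
    proof
      show "?C \<subseteq> cfun.span {f}"
      proof
        fix g assume g: "g \<in> ?C"
        have "g x = 0" if x: "x \<noteq> 0" "f x = 0" for x
        proof (rule inverse_system_vanish[OF _ _ x(1)])
          have less: "degree (line_restriction f a x) < d" for a
          proof -
            \<comment> \<open>The zero polynomial has degree 0, so a vanishing coefficient of
              \<open>t^d\<close> is compatible with degree \<open>d\<close> only if
              \<open>d = 0\<close>; then \<open>f\<close> would be constant, but
              \<open>f x = 0\<close> and \<open>f e \<noteq> 0\<close>.\<close>
            have "degree (line_restriction f a x) \<noteq> d"
            proof
              assume eq: "degree (line_restriction f a x) = d"
              then have "line_restriction f a x = 0"
                using coeff_line_restriction_top[OF f, of a x] x(2) by (metis leading_coeff_0_iff)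
              with eq have "d = 0" by simp
              then show False
                using homogeneous_scale[OF f, of 0 x] homogeneous_scale[OF f, of 0 e] x e by simp
            qed
            then show ?thesis using degree_line_restriction_homogeneous[OF f, of a x] by simp
          qed
          have "degree (line_restriction f a x) \<le> d - 1" for a using less[of a] by linarith
          then have "rho f x \<le> d - 1" by (simp add: rho_le_iff[OF fp])
          then show "rho f x < d" using less[of 0] by linarith
        qed (use g 2 in auto)
        then obtain c where "g = (\<lambda>x. c * f x)"
          using vanishing_on_smooth_imp_multiple[OF f _ nonsing _ e, of g] g 2 by auto
        then show "g \<in> cfun.span {f}" by (simp add: cfun.span_scale cfun.span_base)
      qed
      show "cfun.span {f} \<subseteq> ?C"
      proof
        fix g assume "g \<in> cfun.span {f}"
        then obtain c where g: "g = (\<lambda>x. c * f x)" by (auto simp: cfun.span_singleton)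
        then have gH: "g \<in> homogeneous_polynomials d"
          using f unfolding homogeneous_polynomials_def g by (intro cfun.span_scale)
        note gp = homogeneous_imp_polynomial[OF gH]
        have "line_restriction g a h = smult c (line_restriction f a h)" for a h
          by (rule line_restriction_eqI[OF gp]) (simp add: g poly_line_restriction[OF fp])
        then show "g \<in> ?C"
          using gH gp 2 degree_line_restriction_le_rho[OF fp]
          by (auto simp: inverse_system_def intro: order_trans[OF degree_smult_le])
      qed
    qed
    moreover have "cfun.independent {f}" using f0 by (simp add: zero_fun_def)
    ultimately show ?thesis using 2 by (simp add: cfun.dim_eq_card_independent)
  next
    case 3
    then have "?C \<subseteq> cfun.span {}" using inverse_system_degree_gt[OF f 3] by auto
    then have "cfun.dim ?C \<le> card ({} :: (complex ^ 'n \<Rightarrow> complex) set)"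
      by (rule cfun.dim_le_card) simp
    then show ?thesis using 3 by simp
  qed
qed

section \<open>The drop of the Hilbert function at a singular point\<close>

text \<open>At a singular point \<open>x\<close> two top coefficients vanish, so
  \<open>rho f x < d - 1\<close> and all members of degree \<open>d - 1\<close> vanish at
  \<open>x\<close>. Some monomial of that degree does not, so the dimension is smaller than that of
  all forms.\<close>

lemma dim_inverse_system_imp_smooth:
  fixes f :: "complex ^ 'n::finite \<Rightarrow> complex"
  assumes f: "f \<in> homogeneous_polynomials d" and f0: "f \<noteq> (\<lambda>x. 0)"
    and dim: "d > 0 \<Longrightarrow> cfun.dim (inverse_system (rho f) \<inter> homogeneous_polynomials (d - 1)) =
      (CARD('n) + (d - 1) - 1) choose (d - 1)"
  shows "smooth_hypersurface f"
proof (rule ccontr)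
  assume "\<not> smooth_hypersurface f"
  then obtain x where x0: "x \<noteq> 0" and
    sing: "\<forall>y\<in>vec.span {x} - {0}. f y = 0 \<and> (\<forall>i. partial_derivative i f y = 0)"
    unfolding smooth_hypersurface_def projective_space_def by blast
  have x: "f x = 0" "\<And>i. partial_derivative i f x = 0"
    using sing x0 vec.span_base[of x "{x}"] by auto
  note fp = homogeneous_imp_polynomial[OF f]
  obtain e where e: "f e \<noteq> 0" using f0 by auto
  have d0: "d > 0"
    using homogeneous_scale[OF f, of 0 x] homogeneous_scale[OF f, of 0 e] x e by (cases d) auto
  have coeff0: "coeff (line_restriction f a x) k = 0" if k: "k \<ge> d - 1" for a k
  proof -
    consider "k = d - 1" | "k = d" | "k > d" using k by linarith
    then show ?thesis
    proof cases
      case 1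
      then show ?thesis by (simp only: coeff_line_restriction_pred[OF f d0] x) simp
    next
      case 2
      then show ?thesis by (simp add: coeff_line_restriction_top[OF f] x)
    next
      case 3
      then show ?thesis
        using degree_line_restriction_homogeneous[OF f, of a x] by (simp add: coeff_eq_0)
    qed
  qed
  \<comment> \<open>For \<open>d = 1\<close>, the vanishing coefficient of \<open>t^0\<close> on the
    line through \<open>e\<close> would be \<open>f e\<close>. Hence \<open>d - 2\<close> below is a
    genuine difference.\<close>
  have d1: "d - 1 > 0"
  proof (rule ccontr)
    assume "\<not> d - 1 > 0"
    then have "f e = 0"
      using coeff0[of 0 e] coeff_0_line_restriction[OF fp, of e x] by simp
    with e show False by simp
  qed
  have "degree (line_restriction f a x) \<le> d - 1 - 1" for a
    using coeff0[of _ a] d1 by (intro degree_le) auto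
  then have rho: "rho f x < d - 1" using d1 rho_le_iff[OF fp, of x "d - 1 - 1"] by auto
  let ?C = "inverse_system (rho f) \<inter> homogeneous_polynomials (d - 1)"
  let ?M = "{monomial_fun m | m :: 'n \<Rightarrow> nat. sum m UNIV = d - 1}"
  have vanish: "g x = 0" if "g \<in> ?C" for g
    using that inverse_system_vanish[of g "rho f" "d - 1" x] x0 rho by blast
  obtain B where B: "B \<subseteq> ?C" "cfun.independent B" "?C \<subseteq> cfun.span B" "card B = cfun.dim ?C"
    by (rule cfun.basis_exists)
  have "B \<subseteq> cfun.span ?M" using B(1) unfolding homogeneous_polynomials_def by blast
  then have finB: "finite B" using cfun.independent_span_bound[OF homogeneous_basis(1) B(2)] by blast
  obtain j where j: "x $ j \<noteq> 0" using x0 by (auto simp: vec_eq_iff)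
  \<comment> \<open>The power \<open>d - 1\<close> of a coordinate that is nonzero at
    \<open>x\<close>. Added to a basis of the degree \<open>d - 1\<close> part, it gives an
    independent set with more elements than there are monomials.\<close>
  define m where "m = (\<lambda>i. if i = j then d - 1 else 0)"
  have mx: "monomial_fun m x \<noteq> 0"
    using j by (simp add: monomial_fun_def m_def)
  have mM: "monomial_fun m \<in> ?M" by (auto simp: m_def)
  have "g x = 0" if "g \<in> cfun.span B" for g
    using that
  proof (induction rule: cfun.span_induct_alt)
    case (step c b g)
    then show ?case using vanish B(1) by auto
  qed simp
  then have notin: "monomial_fun m \<notin> cfun.span B" using mx by blast
  then have "cfun.independent (insert (monomial_fun m) B)"
    using B(2) by (simp add: cfun.independent_insert)
  moreover have "insert (monomial_fun m) B \<subseteq> cfun.span ?M"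
    using \<open>B \<subseteq> cfun.span ?M\<close> cfun.span_base[OF mM] by (intro insert_subsetI)
  ultimately have "card (insert (monomial_fun m) B) \<le> card ?M"
    by (rule conjunct2[OF cfun.independent_span_bound[OF homogeneous_basis(1)]])
  moreover have "card (insert (monomial_fun m) B) = Suc (card B)"
    using notin finB cfun.span_base[of _ B] by (intro card_insert_disjoint) blast+
  ultimately show False
    using B(4) dim[OF d0] homogeneous_basis(3)[where 'n = 'n, of "d - 1"] by linarith
qed

section \<open>Comparison of the coefficients of the Hilbert series\<close>

theorem proposition3p1:
  fixes f :: "complex ^ 'n::finite \<Rightarrow> complex" and d :: nat
  assumes "f \<in> homogeneous_polynomials d" and "f \<noteq> (\<lambda>x. 0)"
  shows "hilbert_series (inverse_system (rho f)) =
           (\<Sum>i<d. fps_const (int ((CARD('n) + i - 1) choose i)) * fps_X ^ i) + fps_X ^ d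
         \<longleftrightarrow> smooth_hypersurface f"
proof -
  let ?dim = "\<lambda>i. cfun.dim (inverse_system (rho f) \<inter> homogeneous_polynomials i)"
  let ?c = "\<lambda>i. if i < d then (CARD('n) + i - 1) choose i else if i = d then 1 else 0"
  have "fps_nth ((\<Sum>i<d. fps_const (int ((CARD('n) + i - 1) choose i)) * fps_X ^ i) + fps_X ^ d) k
      = int (?c k)" for k
    by (auto simp: fps_sum_nth if_distrib[of "\<lambda>u. _ * u"] cong: if_cong)
  then have "hilbert_series (inverse_system (rho f)) =
           (\<Sum>i<d. fps_const (int ((CARD('n) + i - 1) choose i)) * fps_X ^ i) + fps_X ^ d
         \<longleftrightarrow> (\<forall>k. ?dim k = ?c k)"
    unfolding fps_eq_iff hilbert_series_def fps_nth_Abs_fps by (simp only: of_nat_eq_iff)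
  also have "\<dots> \<longleftrightarrow> smooth_hypersurface f"
  proof
    assume eq: "\<forall>k. ?dim k = ?c k"
    show "smooth_hypersurface f"
    \<comment> \<open>Smoothness is read off from the coefficient of degree \<open>d - 1\<close>
      alone.\<close>
    proof (rule dim_inverse_system_imp_smooth[OF assms])
      assume "d > 0"
      then show "?dim (d - 1) = (CARD('n) + (d - 1) - 1) choose (d - 1)"
        using eq[rule_format, of "d - 1"] by (simp del: One_nat_def)
    qed
  next
    assume "smooth_hypersurface f"
    then show "\<forall>k. ?dim k = ?c k" using smooth_imp_dim_inverse_system[OF assms] by blast
  qed
  finally show ?thesis .
qed

end
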